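(* Let $\alpha>0$, $\varepsilon>0$, and let $X=\{(\lambda,m_\lambda)\}_{\lambda\in\Lambda}$ be a divisor in $\mathbb{D}$ such that $$\bigcup_{\lambda\in\Lambda}D\left(\lambda,\sqrt{\frac{m_\lambda}{m_\lambda+\alpha+2+\varepsilon}}\right)=\mathbb{D}\setminus K$$ for some compact set $K\subset\mathbb{D}$. Then $X$ is a uniqueness divisor for $\mathcal{A}^2_\alpha$.
   Context: $\mathbb{D}$ is the open unit disk in $\mathbb{C}$. $\mathcal{A}^2_\alpha$ is the space of holomorphic functions $f$ on $\mathbb{D}$ with $\int_{\mathbb{D}}|f(z)|^2\,(1+\alpha)(1-|z|^2)^\alpha\,dx\,dy/\pi<\infty$. For $\lambda\in\mathbb{D}$ and $0<r<1$, $D(\lambda,r)=\{z\in\mathbb{D}:\left|\frac{\lambda-z}{1-\overline{\lambda}z}\right|<r\}$ is the pseudohyperbolic disk. A divisor is a set $X=\{(\lambda,m_\lambda)\}_{\lambda\in\Lambda}$, where $\Lambda\subset\mathbb{D}$ is a set of (distinct) points and each $m_\lambda\ge1$ is an integer (multiplicity). $X$ is a uniqueness divisor for a space $\mathcal{A}$ of holomorphic functions on $\mathbb{D}$ if every $f\in\mathcal{A}$ with $f^{(j)}(\lambda)=0$ for all $\lambda\in\Lambda$ and $0\le j<m_\lambda$ is identically zero. *)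

theory Defs
  imports "HOL-Analysis.Analysis"
begin

definition pseudohyperbolic_disk :: "complex \<Rightarrow> real \<Rightarrow> complex set" where
  "pseudohyperbolic_disk l r =
     {z \<in> ball 0 1. cmod ((l - z) / (1 - cnj l * z)) < r}"

(* Functions are total in HOL: only the values on the unit disk matter here, and two members
   that agree on the disk represent the same element of the space. *)
definition weighted_bergman_space :: "real \<Rightarrow> (complex \<Rightarrow> complex) set" where
  "weighted_bergman_space \<alpha> =
     {f. f holomorphic_on ball 0 1 \<and>
         (\<integral>\<^sup>+z\<in>ball 0 1.
            ennreal ((cmod (f z))\<^sup>2 * (1 + \<alpha>) * (1 - (cmod z)\<^sup>2) powr \<alpha> / pi) \<partial>lborel) < \<infinity>}"

(* A set of pairs (point, multiplicity); single-valuedness says that the points are distinct,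
   i.e. that each point carries exactly one multiplicity. *)
definition divisor :: "(complex \<times> nat) set \<Rightarrow> bool" where
  "divisor X \<longleftrightarrow> single_valued X \<and> (\<forall>(l, m) \<in> X. l \<in> ball 0 1 \<and> 1 \<le> m)"

definition uniqueness_divisor ::
    "(complex \<times> nat) set \<Rightarrow> (complex \<Rightarrow> complex) set \<Rightarrow> bool" where
  "uniqueness_divisor X A \<longleftrightarrow>
     (\<forall>f \<in> A. (\<forall>(l, m) \<in> X. \<forall>j < m. (deriv ^^ j) f l = 0) \<longrightarrow> (\<forall>z \<in> ball 0 1. f z = 0))"

end

theory Submission
  imports Defs "HOL-Complex_Analysis.Complex_Analysis"
begin

text \<open>Write \<open>\<gamma> = \<alpha> + 2 + \<epsilon>\<close>. For \<open>f\<close> in the space, \<open>|f z|\<^sup>2 (1 - |z|\<^sup>2)\<^bsup>\<gamma>\<^esup>\<close> tends to \<open>0\<close> at the unit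
  circle. Multiplying \<open>f\<close> by \<open>z\<^sup>N\<close> with \<open>N\<close> large adds a disk around the origin that contains \<open>K\<close>, so the
  disks of the zeros of \<open>F z = z\<^sup>N f z\<close> cover the whole unit disk. If \<open>F\<close> were not zero, then
  \<open>|F z|\<^sup>2 (1 - |z|\<^sup>2)\<^bsup>\<gamma>\<^esup>\<close> would attain a positive maximum inside one of them. But a zero of order at
  least \<open>m\<close>, moved to the origin, gives the expression \<open>t\<^sup>m (1 - t)\<^bsup>\<gamma>\<^esup> |G|\<^sup>2\<close> with \<open>t = |w|\<^sup>2\<close> and \<open>G\<close>
  holomorphic; as \<open>t\<^sup>m (1 - t)\<^bsup>\<gamma>\<^esup>\<close> increases up to \<open>t = m / (m + \<gamma>)\<close>, the maximum modulus principle
  excludes a maximum there.\<close>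

section \<open>Dividing out a zero of prescribed multiplicity\<close>

text \<open>Induction on \<open>m\<close>: by the Leibniz rule the difference quotient
  \<open>g\<close> of \<open>f\<close> at \<open>a\<close> satisfies f^(j+1)(a) = (j+1) g^(j)(a), so
  its derivatives of order below \<open>m\<close> vanish at \<open>a\<close>. The zero may have
  order above \<open>m\<close>, so nothing is claimed about \<open>h a\<close>, and f = 0 is
  covered.\<close>

lemma holomorphic_factor_of_higher_deriv_zero:
  assumes "f holomorphic_on S" "open S" "a \<in> S"
    and "\<And>j. j < m \<Longrightarrow> (deriv ^^ j) f a = 0"
  obtains h where "h holomorphic_on S" "\<And>z. z \<in> S \<Longrightarrow> f z = (z - a) ^ m * h z"
  using assms
proof (induction m arbitrary: f thesis)
  case 0
  then show ?case by auto
next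
  case (Suc m)
  define g where "g = (\<lambda>z. if z = a then deriv f a else (f z - f a) / (z - a))"
  have holg: "g holomorphic_on S"
    unfolding g_def using Suc.prems by (intro pole_lemma_open)
  have "f a = 0"
    using Suc.prems(5)[of 0] by simp
  then have fg: "f z = (z - a) * g z" for z
    by (simp add: g_def)
  have "(deriv ^^ j) g a = 0" if "j < m" for j
  proof -
    have shift: "(deriv ^^ i) (\<lambda>w. w - a) a = (if i = 1 then 1 else 0)" for i
    proof -
      have "(deriv ^^ i) (\<lambda>w. w - a) a = (deriv ^^ i) (\<lambda>w. w) a - (deriv ^^ i) (\<lambda>w. a) a"
        using Suc.prems by (intro higher_deriv_diff[of _ S]) (auto intro: holomorphic_intros)
      then show ?thesis by simp
    qed
    have "(deriv ^^ Suc j) f a = (deriv ^^ Suc j) (\<lambda>w. (w - a) * g w) a"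
      using fg by presburger
    also have "\<dots> = (\<Sum>i = 0..Suc j. of_nat (Suc j choose i) * (deriv ^^ i) (\<lambda>w. w - a) a
                        * (deriv ^^ (Suc j - i)) g a)"
      using Suc.prems holg by (intro higher_deriv_mult[of _ S]) (auto intro: holomorphic_intros)
    also have "\<dots> = (\<Sum>i \<in> {1}. of_nat (Suc j choose i) * (deriv ^^ i) (\<lambda>w. w - a) a
                        * (deriv ^^ (Suc j - i)) g a)"
      by (rule sum.mono_neutral_right) (auto simp: shift)
    also have "\<dots> = of_nat (Suc j) * (deriv ^^ j) g a"
      using shift[of 1] by simp
    finally show ?thesis
      using Suc.prems(5)[of "Suc j"] that by (auto simp del: of_nat_Suc funpow.simps)
  qed
  then obtain h where "h holomorphic_on S" "\<And>z. z \<in> S \<Longrightarrow> g z = (z - a) ^ m * h z"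
    using Suc.IH[of g] holg Suc.prems by blast
  then show ?case
    using Suc.prems(1)[of h] fg by simp
qed

section \<open>Growth of weighted Bergman functions towards the unit circle\<close>

text \<open>Cauchy's inequality on disks of radius \<open>d / 2\<close> gives |f'| \<le> 2 L |f a| /
  d on \<open>ball a (d / 2)\<close>; over a distance below \<open>d / (4 * L)\<close> the value of
  \<open>f\<close> then changes by at most |f a| / 2.\<close>

lemma holomorphic_half_norm_nearby:
  assumes holf: "f holomorphic_on ball a d" and d: "d > 0" and L: "L \<ge> 1"
    and bound: "\<And>z. z \<in> ball a d \<Longrightarrow> norm (f z) \<le> L * norm (f a)"
    and z: "z \<in> ball a (d / (4 * L))"
  shows "norm (f a) / 2 \<le> norm (f z)"
proof -
  have der: "norm (deriv f w) \<le> 2 * L * norm (f a) / d" if w: "w \<in> ball a (d / 2)" for w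
  proof -
    have sub: "cball w (d / 2) \<subseteq> ball a d"
    proof
      fix x assume "x \<in> cball w (d / 2)"
      then show "x \<in> ball a d"
        using w dist_triangle[of a x w] by simp
    qed
    then have "norm ((deriv ^^ 1) f w) \<le> fact 1 * (L * norm (f a)) / (d / 2) ^ 1"
    proof (intro Cauchy_inequality)
      show "f holomorphic_on ball w (d / 2)"
        using sub holf ball_subset_cball by (blast intro: holomorphic_on_subset)
      show "continuous_on (cball w (d / 2)) f"
        using sub holf by (meson holomorphic_on_imp_continuous_on holomorphic_on_subset)
      fix x assume "cmod (w - x) = d / 2"
      then have "x \<in> ball a d"
        using sub by (auto simp: dist_norm)
      then show "norm (f x) \<le> L * norm (f a)"
        by (rule bound)
    qed (use d in auto)
    then show ?thesis by (simp add: field_simps)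
  qed
  have "d / (4 * L) < d / 2"
    using d L by (simp add: field_simps)
  then have zin: "z \<in> ball a (d / 2)"
    using z by simp
  have "norm (f z - f a) \<le> (2 * L * norm (f a) / d) * norm (z - a)"
  proof (rule field_differentiable_bound)
    fix w assume w: "w \<in> ball a (d / 2)"
    then have "w \<in> ball a d" using d by simp
    then show "(f has_field_derivative deriv f w) (at w within ball a (d / 2))"
      using holf holomorphic_derivI by (blast intro: has_field_derivative_at_within)
  qed (use der zin d in auto)
  also have "\<dots> \<le> (2 * L * norm (f a) / d) * (d / (4 * L))"
    using z L d by (intro mult_left_mono) (auto simp: dist_norm norm_minus_commute)
  also have "\<dots> = norm (f a) / 2"
    using L d by (simp add: field_simps)
  finally show ?thesis
    using norm_triangle_ineq2[of "f a" "f z"] by (simp add: norm_minus_commute)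
qed

text \<open>At a maximum point \<open>a\<close> of \<open>|f z|\<^sup>2 (\<rho> - |z|)\<^bsup>\<alpha> + 2\<^esup>\<close>, the Cauchy estimate gives \<open>|f| \<ge> |f a| / 2\<close> on a
  ball of radius proportional to \<open>\<rho> - |a|\<close>, and the area integral over this ball bounds the maximum
  uniformly in \<open>\<rho>\<close>. This replaces the area mean value inequality.\<close>

lemma weighted_bergman_space_growth:
  assumes \<alpha>: "\<alpha> > 0" and f: "f \<in> weighted_bergman_space \<alpha>"
  obtains C where "\<And>z. norm z < 1 \<Longrightarrow> (norm (f z))\<^sup>2 * (1 - norm z) powr (\<alpha> + 2) \<le> C"
proof -
  define b where "b = \<alpha> + 2"
  \<comment> \<open>Halving \<open>\<rho> - norm z\<close> costs a factor \<open>2 powr b\<close> in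
    the weight, hence \<open>L\<close> in the modulus of \<open>f\<close>.\<close>
  define L :: real where "L = 2 powr (b / 2)"
  define w where "w z = (cmod (f z))\<^sup>2 * (1 + \<alpha>) * (1 - (cmod z)\<^sup>2) powr \<alpha> / pi" for z
  define I where "I = enn2real (\<integral>\<^sup>+z\<in>ball 0 1. ennreal (w z) \<partial>lborel)"
  \<comment> \<open>Here 256 = 4 * 64: the 4 comes from squaring |f a| / 2, the 64 and
    \<open>L\<^sup>2\<close> from \<open>d = 8 * L * s\<close>, and \<open>2 powr \<alpha>\<close>
    from the weight \<open>(d / 2) powr \<alpha>\<close>.\<close>
  define C where "C = I * 256 * L\<^sup>2 * 2 powr \<alpha> / (1 + \<alpha>)"
  have holf: "f holomorphic_on ball 0 1"
    and I: "(\<integral>\<^sup>+z\<in>ball 0 1. ennreal (w z) \<partial>lborel) = ennreal I"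
    using f by (auto simp: weighted_bergman_space_def I_def w_def less_top)
  have I0: "I \<ge> 0" by (simp add: I_def)
  have L1: "L \<ge> 1"
    using \<alpha> by (simp add: L_def b_def ge_one_powr_ge_zero)
  have L2: "L\<^sup>2 = 2 powr b"
    by (simp add: L_def power2_eq_square flip: powr_add)
  have inner: "(norm (f z))\<^sup>2 * (\<rho> - norm z) powr b \<le> C"
    if \<rho>: "\<rho> < 1" and z: "norm z \<le> \<rho>" for \<rho> z
  proof -
    define v where "v z = (norm (f z))\<^sup>2 * (\<rho> - norm z) powr b" for z
    have contf: "continuous_on (cball 0 \<rho>) f"
      using \<rho> holf by (intro holomorphic_on_imp_continuous_on) (auto elim!: holomorphic_on_subset)
    have "continuous_on (cball 0 \<rho>) v"
      unfolding v_def using \<alpha> by (intro continuous_intros continuous_on_powr' contf) (auto simp: b_def)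
    moreover have "cball (0::complex) \<rho> \<noteq> {}" using order_trans[OF norm_ge_zero z] by simp
    ultimately obtain a where a: "a \<in> cball 0 \<rho>" and max: "\<And>y. y \<in> cball 0 \<rho> \<Longrightarrow> v y \<le> v a"
      using continuous_attains_sup[of "cball 0 \<rho>" v] by auto
    define d where "d = \<rho> - norm a"
    have "v a \<le> C"
    proof (cases "d = 0")
      \<comment> \<open>By convention \<open>0 powr b = 0\<close>, so
        \<open>v a = 0\<close>.\<close>
      case True
      then show ?thesis
        using I0 \<alpha> by (simp add: v_def d_def C_def)
    next
      case False
      then have d: "d > 0" using a by (simp add: d_def)
      have near: "norm y \<le> \<rho> - d / 2" if "y \<in> ball a (d / 2)" for y
        using that norm_triangle_ineq2[of y a]
        unfolding d_def mem_ball dist_norm norm_minus_commute[of a y] by argo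
      \<comment> \<open>The weight at \<open>y\<close> is at least \<open>(d / 2) powr b\<close>,
        the weight at \<open>a\<close> is \<open>d powr b\<close>, and \<open>v y\<close> does not
        exceed the maximum \<open>v a\<close>.\<close>
      have bound: "norm (f y) \<le> L * norm (f a)" if y: "y \<in> ball a (d / 2)" for y
      proof -
        have "(norm (f y))\<^sup>2 * (d / 2) powr b \<le> v y"
          unfolding v_def using near[OF y] d \<alpha>
          by (intro mult_left_mono powr_mono2) (auto simp: b_def)
        also have "\<dots> \<le> v a"
          using near[OF y] d by (intro max) simp
        also have "v a = (norm (f a))\<^sup>2 * (L\<^sup>2 * (d / 2) powr b)"
          using d by (simp add: v_def d_def L2 powr_divide)
        also have "\<dots> = (L * norm (f a))\<^sup>2 * (d / 2) powr b"
          by (simp add: power_mult_distrib)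
        finally have "(norm (f y))\<^sup>2 \<le> (L * norm (f a))\<^sup>2"
          using d by (simp add: mult_le_cancel_right)
        then show ?thesis
          by (rule power2_le_imp_le) (use L1 in simp)
      qed
      \<comment> \<open>The radius given by \<open>holomorphic_half_norm_nearby\<close> on
        \<open>ball a (d / 2)\<close>.\<close>
      define s where "s = d / 2 / (4 * L)"
      define c0 where "c0 = (norm (f a))\<^sup>2 / 4 * (1 + \<alpha>) * (d / 2) powr \<alpha> / pi"
      have s: "s > 0" "s \<le> d / 2"
        using L1 d by (auto simp: s_def field_simps)
      have sub: "ball a (d / 2) \<subseteq> ball 0 1"
        using near d \<rho> by fastforce
      then have sub_s: "ball a s \<subseteq> ball 0 1"
        using s by fastforce
      have half: "norm (f a) / 2 \<le> norm (f y)" if "y \<in> ball a s" for y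
        using holomorphic_half_norm_nearby[OF holomorphic_on_subset[OF holf sub] _ L1 bound] d that
        by (simp add: s_def)
      \<comment> \<open>Combines |f y| \<ge> |f a| / 2 with 1 - |y|^2 \<ge> 1 - |y| \<ge> d /
        2.\<close>
      have lower: "c0 \<le> w y" if y: "y \<in> ball a s" for y
      proof -
        have y': "y \<in> ball a (d / 2)" using y s by simp
        have "norm y * norm y \<le> 1 * norm y"
          using sub y' by (intro mult_right_mono) auto
        then have "d / 2 \<le> 1 - (norm y)\<^sup>2"
          using near[OF y'] \<rho> by (simp add: power2_eq_square)
        moreover have "(norm (f a) / 2)\<^sup>2 \<le> (norm (f y))\<^sup>2"
          using half[OF y] by (intro power_mono) auto
        ultimately show ?thesis
          unfolding c0_def w_def using \<alpha> d
          by (intro divide_right_mono mult_mono powr_mono2) (auto simp: power_divide)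
      qed
      have c0: "c0 \<ge> 0" using \<alpha> by (simp add: c0_def)
      have "ennreal (c0 * (pi * s\<^sup>2)) = ennreal c0 * emeasure lborel (ball a s)"
        using c0 s by (simp add: emeasure_ball unit_ball_vol_2 ennreal_mult)
      also have "\<dots> = (\<integral>\<^sup>+y. ennreal c0 * indicator (ball a s) y \<partial>lborel)"
        by (simp add: nn_integral_cmult_indicator)
      also have "\<dots> \<le> (\<integral>\<^sup>+y\<in>ball 0 1. ennreal (w y) \<partial>lborel)"
        using lower sub_s by (intro nn_integral_mono) (auto simp: indicator_def intro!: ennreal_leI)
      finally have "c0 * (pi * s\<^sup>2) \<le> I"
        using I I0 by simp
      moreover have "v a = c0 * (pi * s\<^sup>2) * (256 * L\<^sup>2 * 2 powr \<alpha> / (1 + \<alpha>))"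
      proof -
        have "d\<^sup>2 = 64 * (L\<^sup>2 * s\<^sup>2)"
          using L1 by (simp add: s_def power2_eq_square field_simps)
        then show ?thesis
          using \<alpha> d by (simp add: v_def c0_def b_def powr_add powr_divide flip: d_def)
      qed
      moreover have "256 * L\<^sup>2 * 2 powr \<alpha> / (1 + \<alpha>) \<ge> 0"
        using \<alpha> by simp
      ultimately have "v a \<le> I * (256 * L\<^sup>2 * 2 powr \<alpha> / (1 + \<alpha>))"
        using mult_right_mono by metis
      then show ?thesis by (simp add: C_def mult.assoc)
    qed
    then show ?thesis
      using max[of z] z by (simp add: v_def)
  qed
  \<comment> \<open>Since \<open>C\<close> does not depend on \<open>\<rho>\<close>, the bound
    survives the limit \<rho> \<longlongrightarrow> 1.\<close>
  have "(norm (f z))\<^sup>2 * (1 - norm z) powr b \<le> C" if z: "norm z < 1" for z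
  proof (rule tendsto_upperbound)
    show "((\<lambda>\<rho>. (norm (f z))\<^sup>2 * (\<rho> - norm z) powr b) \<longlongrightarrow> (norm (f z))\<^sup>2 * (1 - norm z) powr b)
            (at_left 1)"
      using z by (intro tendsto_intros) auto
    show "\<forall>\<^sub>F \<rho> in at_left 1. (norm (f z))\<^sup>2 * (\<rho> - norm z) powr b \<le> C"
      using eventually_at_left_real[OF z] by eventually_elim (auto intro: inner)
  qed simp
  then show thesis
    using that unfolding b_def by blast
qed

section \<open>Excluding a maximum in the disk of a zero\<close>

text \<open>The derivative is x^(m-1) (1-x)^(\<gamma>-1) (m (1-x) - \<gamma> x), whose last factor
  changes sign at m / (m + \<gamma>). With x = |w|^2 this is the source of the radius of the
  disks.\<close>

lemma power_mult_powr_strict_increasing: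
  fixes \<gamma> :: real
  assumes "m \<ge> 1" "\<gamma> > 0" "0 \<le> s" "s < t" "t \<le> real m / (real m + \<gamma>)"
  shows "s ^ m * (1 - s) powr \<gamma> < t ^ m * (1 - t) powr \<gamma>"
proof (rule DERIV_pos_imp_increasing_open[OF \<open>s < t\<close>])
  have t1: "t < 1"
    using assms by (smt (verit) divide_less_eq_1_pos of_nat_0_le_iff)
  show "continuous_on {s..t} (\<lambda>x. x ^ m * (1 - x) powr \<gamma>)"
    using t1 by (intro continuous_intros) auto
  fix x assume x: "s < x" "x < t"
  have x01: "0 < x" "x < 1" using x t1 assms by auto
  have "x < real m / (real m + \<gamma>)" using x assms by simp
  then have pos: "real m * (1 - x) - \<gamma> * x > 0"
    using assms by (simp add: pos_less_divide_eq algebra_simps)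
  have "((\<lambda>x. x ^ m * (1 - x) powr \<gamma>) has_real_derivative
          x ^ m * (- \<gamma> * (1 - x) powr (\<gamma> - 1)) + real m * x ^ (m - 1) * (1 - x) powr \<gamma>) (at x)"
    using x01 by (auto intro!: derivative_eq_intros)
  moreover have "x ^ m * (- \<gamma> * (1 - x) powr (\<gamma> - 1)) + real m * x ^ (m - 1) * (1 - x) powr \<gamma>
      = x ^ (m - 1) * (1 - x) powr (\<gamma> - 1) * (real m * (1 - x) - \<gamma> * x)"
  proof -
    have 1: "x ^ m = x ^ (m - 1) * x"
      using assms(1) by (simp add: power_eq_if)
    have 2: "(1 - x) powr \<gamma> = (1 - x) powr (\<gamma> - 1) * (1 - x)"
      using x01 by (simp add: powr_diff)
    have "A * x * (- \<gamma> * P) + n * A * (P * (1 - x)) = A * P * (n * (1 - x) - \<gamma> * x)" for A P n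
      by (simp add: algebra_simps)
    then show ?thesis unfolding 1 2 .
  qed
  moreover have "x ^ (m - 1) * (1 - x) powr (\<gamma> - 1) * (real m * (1 - x) - \<gamma> * x) > 0"
    using x01 pos by (intro mult_pos_pos) auto
  ultimately show "\<exists>y. ((\<lambda>x. x ^ m * (1 - x) powr \<gamma>) has_real_derivative y) (at x) \<and> 0 < y"
    by (intro exI[of _ "x ^ (m - 1) * (1 - x) powr (\<gamma> - 1) * (real m * (1 - x) - \<gamma> * x)"]) (simp only: simp_thms)
qed

text \<open>Take \<open>y\<close> where |G| is largest on the circle of critical radius
  \<open>r\<close>: the maximum modulus principle gives |G w| \<le> |G y|, and the radial factor is
  strictly larger at \<open>r\<close>. \<open>G w \<noteq> 0\<close> keeps the product inequality
  strict.\<close>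

lemma weighted_norm_exceeded_centered:
  assumes holG: "G holomorphic_on ball 0 1" and m: "m \<ge> 1" and \<gamma>: "\<gamma> > 0"
    and w: "norm w < sqrt (real m / (real m + \<gamma>))" and Gw: "G w \<noteq> 0"
  obtains y where "norm y < 1"
    "(norm (w ^ m * G w))\<^sup>2 * (1 - (norm w)\<^sup>2) powr \<gamma>
       < (norm (y ^ m * G y))\<^sup>2 * (1 - (norm y)\<^sup>2) powr \<gamma>"
proof -
  define r where "r = sqrt (real m / (real m + \<gamma>))"
  have r: "0 < r" "r < 1" "r\<^sup>2 = real m / (real m + \<gamma>)"
    using m \<gamma> by (auto simp: r_def)
  have sub: "cball 0 r \<subseteq> ball (0::complex) 1"
    using r by auto
  have contG: "continuous_on (cball 0 r) G"
    using sub holG by (meson holomorphic_on_imp_continuous_on holomorphic_on_subset)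
  have "sphere (0::complex) r \<noteq> {}" using r by simp
  then obtain y where y: "y \<in> sphere 0 r" and ymax: "\<And>x. x \<in> sphere 0 r \<Longrightarrow> norm (G x) \<le> norm (G y)"
    using continuous_attains_sup[of "sphere 0 r" "\<lambda>x. norm (G x)"]
      continuous_on_norm[OF continuous_on_subset[OF contG sphere_cball]] by auto
  have "norm (G w) \<le> norm (G y)"
  proof (rule maximum_modulus_frontier[of G "cball 0 r"])
    show "G holomorphic_on interior (cball 0 r)"
      using holG sub interior_subset by (blast intro: holomorphic_on_subset)
  qed (use contG ymax w in \<open>auto simp: r_def\<close>)
  then have G_le: "(norm (G w))\<^sup>2 \<le> (norm (G y))\<^sup>2"
    by (intro power_mono) auto
  have "(norm w)\<^sup>2 < r\<^sup>2"
    using w by (intro power_strict_mono) (auto simp: r_def)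
  then have p_less: "((norm w)\<^sup>2) ^ m * (1 - (norm w)\<^sup>2) powr \<gamma> < (r\<^sup>2) ^ m * (1 - r\<^sup>2) powr \<gamma>"
    using r(3) m \<gamma> by (intro power_mult_powr_strict_increasing) simp_all
  have "(((norm w)\<^sup>2) ^ m * (1 - (norm w)\<^sup>2) powr \<gamma>) * (norm (G w))\<^sup>2
      < (r\<^sup>2) ^ m * (1 - r\<^sup>2) powr \<gamma> * (norm (G y))\<^sup>2"
    by (rule mult_less_le_imp_less[OF p_less G_le]) (use Gw in auto)
  moreover have "(norm (x ^ m * G x))\<^sup>2 = ((norm x)\<^sup>2) ^ m * (norm (G x))\<^sup>2" for x
    by (simp add: norm_mult norm_power power_mult_distrib mult.commute flip: power_mult)
  ultimately show thesis
    using y r(1,2) by (intro that[of y]) (auto simp: mult_ac)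
qed

text \<open>The substitution \<open>z = (w + l) / (1 + cnj l * w)\<close> moves \<open>l\<close> to the origin; the factor by which it
  changes the weight is the squared modulus of a nonvanishing holomorphic function.\<close>

lemma weighted_norm_exceeded:
  assumes holh: "h holomorphic_on ball 0 1" and l: "norm l < 1" and m: "m \<ge> 1" and \<gamma>: "\<gamma> > 0"
    and F: "\<And>z. z \<in> ball 0 1 \<Longrightarrow> F z = (z - l) ^ m * h z"
    and z: "z \<in> pseudohyperbolic_disk l (sqrt (real m / (real m + \<gamma>)))" and Fz: "F z \<noteq> 0"
  obtains y where "norm y < 1"
    "(norm (F z))\<^sup>2 * (1 - (norm z)\<^sup>2) powr \<gamma> < (norm (F y))\<^sup>2 * (1 - (norm y)\<^sup>2) powr \<gamma>"
proof -
  define \<phi> where "\<phi> = Moebius_function 0 (- l)"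
  define k where "k = 1 - (norm l)\<^sup>2"
  \<comment> \<open>Chosen so that \<open>w ^ m * G w = F (\<phi> w) * (1 + cnj l * w) powr (-
    of_real \<gamma>)\<close>; the factor \<open>k / (1 + cnj l * w)\<close> is (\<phi> w - l) /
    w.\<close>
  define G where "G w = (k / (1 + cnj l * w)) ^ m * h (\<phi> w) * (1 + cnj l * w) powr (- of_real \<gamma>)" for w
  have k: "k > 0" using l by (simp add: k_def power_less_one_iff)
  \<comment> \<open>Positive real part keeps the base of the complex power off the branch
    cut.\<close>
  have re: "Re (1 + cnj l * w) > 0" if "norm w < 1" for w
  proof -
    have "norm (cnj l * w) < 1" using that l norm_mult_less[of "cnj l" 1 w 1] by simp
    then show ?thesis using abs_Re_le_cmod[of "cnj l * w"] by (simp only: plus_complex.sel one_complex.sel)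
  qed
  have nz: "1 + cnj l * w \<noteq> 0" if "norm w < 1" for w
    using re[OF that] by (metis less_irrefl zero_complex.sel(1))
  have \<phi>: "\<phi> w = (w + l) / (1 + cnj l * w)" for w
    by (simp add: \<phi>_def Moebius_function_simple)
  have norm\<phi>: "norm (\<phi> w) < 1" if "norm w < 1" for w
    unfolding \<phi>_def using l that by (intro Moebius_function_norm_lt_1) auto
  have hol\<phi>: "\<phi> holomorphic_on ball 0 1"
    unfolding \<phi>_def using l by (intro Moebius_function_holomorphic) auto
  have "(h \<circ> \<phi>) holomorphic_on ball 0 1"
    using norm\<phi> by (intro holomorphic_on_compose_gen[OF hol\<phi> holh]) auto
  then have holG: "G holomorphic_on ball 0 1"
    unfolding G_def o_def using nz re
    by (intro holomorphic_intros) (auto simp: complex_nonpos_Reals_iff dest: re)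
  \<comment> \<open>Rests on 1 - |\<phi> w|^2 = k (1 - |w|^2) / |1 + cnj l w|^2. The constant
    \<open>k powr \<gamma>\<close> is positive, so comparisons carry over.\<close>
  have weight: "(norm (F (\<phi> w)))\<^sup>2 * (1 - (norm (\<phi> w))\<^sup>2) powr \<gamma>
      = k powr \<gamma> * ((norm (w ^ m * G w))\<^sup>2 * (1 - (norm w)\<^sup>2) powr \<gamma>)" if w: "norm w < 1" for w
  proof -
    define q where "q = 1 + cnj l * w"
    have q: "q \<noteq> 0" using nz[OF w] by (simp add: q_def)
    have "\<phi> w - l = w * (k / q)"
      using q complex_norm_square[of l] by (simp add: \<phi> k_def q_def field_simps)
    then have 1: "F (\<phi> w) = w ^ m * (k / q) ^ m * h (\<phi> w)"
      using F[of "\<phi> w"] norm\<phi>[OF w] by (simp only: power_mult_distrib) simp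
    have "(norm q)\<^sup>2 - (norm (w + l))\<^sup>2 = k * (1 - (norm w)\<^sup>2)"
      unfolding q_def k_def cmod_power2 by (simp add: power2_eq_square algebra_simps)
    then have 2: "1 - (norm (\<phi> w))\<^sup>2 = k * (1 - (norm w)\<^sup>2) / (norm q)\<^sup>2"
      using q unfolding \<phi> q_def[symmetric] by (simp add: norm_divide power_divide field_simps)
    have 3: "(norm (q powr (- of_real \<gamma>)))\<^sup>2 = ((norm q)\<^sup>2) powr (- \<gamma>)"
      using q by (simp add: norm_powr_real_powr' power2_eq_square powr_mult flip: powr_add)
    have "1 - (norm w)\<^sup>2 \<ge> 0"
      using w by (simp add: power_le_one_iff)
    then have 4: "(1 - (norm (\<phi> w))\<^sup>2) powr \<gamma>
        = k powr \<gamma> * (1 - (norm w)\<^sup>2) powr \<gamma> * ((norm q)\<^sup>2) powr (- \<gamma>)"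
      unfolding 2 using k by (simp add: powr_mult powr_divide powr_minus_divide)
    have 5: "w ^ m * G w = F (\<phi> w) * q powr (- of_real \<gamma>)"
      unfolding 1 G_def q_def by (simp add: mult.assoc)
    show ?thesis
      unfolding 4 5 norm_mult power_mult_distrib 3 by (simp add: mult_ac)
  qed
  \<comment> \<open>The preimage of \<open>z\<close> under \<open>\<phi>\<close>; its modulus is the
    pseudohyperbolic distance from \<open>l\<close> to \<open>z\<close>.\<close>
  define w where "w = Moebius_function 0 l z"
  have z1: "norm z < 1"
    using z by (simp add: pseudohyperbolic_disk_def)
  have w1: "norm w < 1"
    unfolding w_def using l z1 by (intro Moebius_function_norm_lt_1)
  have \<phi>w: "\<phi> w = z"
    unfolding \<phi>_def w_def using l z1 by (intro Moebius_function_compose) auto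
  have "norm w < sqrt (real m / (real m + \<gamma>))"
    using z by (simp add: w_def Moebius_function_simple pseudohyperbolic_disk_def norm_divide norm_minus_commute)
  moreover have "(norm z)\<^sup>2 < 1"
    using z1 by (simp add: abs_square_less_1)
  then have "G w \<noteq> 0"
    using weight[OF w1] Fz k \<phi>w by auto
  ultimately obtain y where y: "norm y < 1"
    "(norm (w ^ m * G w))\<^sup>2 * (1 - (norm w)\<^sup>2) powr \<gamma>
       < (norm (y ^ m * G y))\<^sup>2 * (1 - (norm y)\<^sup>2) powr \<gamma>"
    using weighted_norm_exceeded_centered[OF holG m \<gamma>] by blast
  then show thesis
    using weight[OF w1] weight[OF y(1)] \<phi>w k norm\<phi>[OF y(1)]
    by (intro that[of "\<phi> y"]) (auto intro: mult_strict_left_mono)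
qed

section \<open>Existence of a maximum\<close>

text \<open>As 1 - |z|^2 \<le> 2 (1 - |z|), the expression is at most C 2^\<gamma> (1 -
  |z|)^(\<gamma> - b), which tends to 0 at the circle because b < \<gamma>. Its supremum is
  therefore attained on a smaller closed disk.\<close>

lemma weighted_norm_attains_max:
  fixes F :: "complex \<Rightarrow> complex"
  assumes contF: "continuous_on (ball 0 1) F" and b: "0 < b" and \<gamma>: "b < \<gamma>"
    and bound: "\<And>z. norm z < 1 \<Longrightarrow> (norm (F z))\<^sup>2 * (1 - norm z) powr b \<le> C"
    and z0: "norm z0 < 1" "F z0 \<noteq> 0"
  obtains a where "norm a < 1" "F a \<noteq> 0"
    "\<And>z. norm z < 1 \<Longrightarrow>
      (norm (F z))\<^sup>2 * (1 - (norm z)\<^sup>2) powr \<gamma> \<le> (norm (F a))\<^sup>2 * (1 - (norm a)\<^sup>2) powr \<gamma>"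
proof -
  define u where "u z = (norm (F z))\<^sup>2 * (1 - (norm z)\<^sup>2) powr \<gamma>" for z
  have "(norm z0)\<^sup>2 < 1"
    using z0 by (simp add: abs_square_less_1)
  then have u0: "u z0 > 0"
    using z0 by (simp add: u_def)
  have ubound: "u z \<le> C * 2 powr \<gamma> * (1 - norm z) powr (\<gamma> - b)" if z: "norm z < 1" for z
  proof -
    have "1 - (norm z)\<^sup>2 = (1 - norm z) * (1 + norm z)"
      by (simp add: power2_eq_square algebra_simps)
    also have "\<dots> \<le> (1 - norm z) * 2"
      using z by (intro mult_left_mono) auto
    finally have "(1 - (norm z)\<^sup>2) powr \<gamma> \<le> ((1 - norm z) * 2) powr \<gamma>"
      using z b \<gamma> by (intro powr_mono2) (auto simp: power_le_one)
    also have "\<dots> = (1 - norm z) powr b * (2 powr \<gamma> * (1 - norm z) powr (\<gamma> - b))"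
      using powr_add[of "1 - norm z" b "\<gamma> - b"] z powr_mult[of "1 - norm z" 2 \<gamma>] by simp
    finally have "u z \<le> (norm (F z))\<^sup>2 * ((1 - norm z) powr b * (2 powr \<gamma> * (1 - norm z) powr (\<gamma> - b)))"
      unfolding u_def by (intro mult_left_mono) auto
    also have "\<dots> = ((norm (F z))\<^sup>2 * (1 - norm z) powr b) * (2 powr \<gamma> * (1 - norm z) powr (\<gamma> - b))"
      by (simp add: mult.assoc)
    also have "\<dots> \<le> C * (2 powr \<gamma> * (1 - norm z) powr (\<gamma> - b))"
      using bound[OF z] by (intro mult_right_mono) auto
    finally show ?thesis by (simp add: mult.assoc)
  qed
  have "((\<lambda>\<rho>. (1 - \<rho>) powr (\<gamma> - b)) \<longlongrightarrow> (1 - 1) powr (\<gamma> - b)) (at_left 1)"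
  proof (rule tendsto_powr')
    have "\<forall>\<^sub>F x in at_left 1. 0 \<le> 1 - (x::real)"
      using eventually_at_left_real[of 0 1] by (auto elim: eventually_mono)
    then show "(1::real) - 1 \<noteq> 0 \<or> 0 < \<gamma> - b \<and> (\<forall>\<^sub>F x in at_left 1. 0 \<le> 1 - (x::real))"
      using \<gamma> by simp
  qed (intro tendsto_intros)+
  then have "((\<lambda>\<rho>. C * 2 powr \<gamma> * (1 - \<rho>) powr (\<gamma> - b)) \<longlongrightarrow> C * 2 powr \<gamma> * (1 - 1) powr (\<gamma> - b)) (at_left 1)"
    by (rule tendsto_mult_left)
  then have "\<forall>\<^sub>F \<rho> in at_left 1. C * 2 powr \<gamma> * (1 - \<rho>) powr (\<gamma> - b) < u z0"
    using u0 by (intro order_tendstoD(2)) auto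
  moreover have "\<forall>\<^sub>F \<rho> in at_left 1. \<rho> \<in> {norm z0<..<1}"
    using z0 by (intro eventually_at_left_real)
  ultimately have "\<forall>\<^sub>F \<rho> in at_left (1::real). C * 2 powr \<gamma> * (1 - \<rho>) powr (\<gamma> - b) < u z0 \<and> \<rho> \<in> {norm z0<..<1}"
    by (rule eventually_conj)
  \<comment> \<open>Beyond radius \<open>\<rho>\<close> the function \<open>u\<close> stays below
    \<open>u z0\<close>, so its maximum over \<open>cball 0 \<rho>\<close> is global.\<close>
  then obtain \<rho> where \<rho>: "C * 2 powr \<gamma> * (1 - \<rho>) powr (\<gamma> - b) < u z0" "norm z0 < \<rho>" "\<rho> < 1"
    using eventually_happens[of _ "at_left (1::real)"] by auto
  have C: "C \<ge> 0"
    using order.trans[OF _ bound[OF z0(1)]] by simp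
  have "continuous_on (cball 0 \<rho>) u"
    unfolding u_def using \<rho> b \<gamma> contF
    by (intro continuous_intros continuous_on_powr') (auto elim!: continuous_on_subset simp: power_le_one)
  moreover have "cball (0::complex) \<rho> \<noteq> {}"
    using order.strict_trans1[OF norm_ge_zero \<rho>(2)] by simp
  ultimately obtain a where a: "a \<in> cball 0 \<rho>" and max: "\<And>y. y \<in> cball 0 \<rho> \<Longrightarrow> u y \<le> u a"
    using continuous_attains_sup[of "cball 0 \<rho>" u] by auto
  have ua: "u z0 \<le> u a"
    using \<rho> by (intro max) auto
  have "u z \<le> u a" if z: "norm z < 1" for z
  proof (cases "norm z \<le> \<rho>")
    case True
    then show ?thesis by (intro max) auto
  next
    case False
    then have "C * 2 powr \<gamma> * (1 - norm z) powr (\<gamma> - b) \<le> C * 2 powr \<gamma> * (1 - \<rho>) powr (\<gamma> - b)"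
      using C z \<gamma> by (intro mult_left_mono powr_mono2) auto
    then show ?thesis
      using ubound[OF z] \<rho> ua by linarith
  qed
  moreover have "F a \<noteq> 0"
    using ua u0 by (auto simp: u_def)
  ultimately show thesis
    using that[of a] a \<rho> by (auto simp: u_def)
qed

section \<open>Covering the disk and concluding uniqueness\<close>

theorem theorem1p6:
  fixes \<alpha> \<epsilon> :: real and X :: "(complex \<times> nat) set" and K :: "complex set"
  assumes "\<alpha> > 0" and "\<epsilon> > 0"
    and "divisor X"
    and "compact K" and "K \<subseteq> ball 0 1"
    and "(\<Union>(l, m)\<in>X. pseudohyperbolic_disk l (sqrt (real m / (real m + \<alpha> + 2 + \<epsilon>)))) = ball 0 1 - K"
  shows "uniqueness_divisor X (weighted_bergman_space \<alpha>)"
  unfolding uniqueness_divisor_def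
proof (intro ballI impI)
  fix f z0
  assume f: "f \<in> weighted_bergman_space \<alpha>"
    and van: "\<forall>(l, m) \<in> X. \<forall>j < m. (deriv ^^ j) f l = 0" and z0: "z0 \<in> ball (0::complex) 1"
  define \<gamma> where "\<gamma> = \<alpha> + 2 + \<epsilon>"
  have \<gamma>: "\<gamma> > 0" using assms(1,2) by (simp add: \<gamma>_def)
  have holf: "f holomorphic_on ball 0 1"
    using f by (simp add: weighted_bergman_space_def)
  obtain s where s: "s < 1" "\<And>z. z \<in> K \<Longrightarrow> norm z \<le> s"
  proof (cases "K = {}")
    case False
    then obtain k where "k \<in> K" "\<And>z. z \<in> K \<Longrightarrow> norm z \<le> norm k"
      using continuous_attains_sup[of K norm] assms(4) by (auto intro: continuous_intros)
    then show ?thesis using that[of "norm k"] assms(5) by auto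
  qed (use that[of 0] in auto)
  \<comment> \<open>The disk around 0 of multiplicity \<open>n\<close> is a Euclidean disk whose
    radius tends to 1, so it eventually exceeds \<open>s\<close>.\<close>
  have "(\<lambda>n. sqrt (real n / (real n + \<gamma>))) \<longlonglongrightarrow> sqrt 1"
    by (intro tendsto_real_sqrt) real_asymp
  then have "\<forall>\<^sub>F n in sequentially. s < sqrt (real n / (real n + \<gamma>))"
    using s by (intro order_tendstoD(1)) auto
  then have "\<forall>\<^sub>F n in sequentially. s < sqrt (real n / (real n + \<gamma>)) \<and> 1 \<le> n"
    using eventually_ge_at_top by (rule eventually_conj)
  then obtain N where N: "s < sqrt (real N / (real N + \<gamma>))" "1 \<le> N"
    by (auto simp: eventually_sequentially)
  define F where "F z = z ^ N * f z" for z
  have holF: "F holomorphic_on ball 0 1"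
    unfolding F_def by (intro holomorphic_intros holf)
  obtain C where C: "\<And>z. norm z < 1 \<Longrightarrow> (norm (f z))\<^sup>2 * (1 - norm z) powr (\<alpha> + 2) \<le> C"
    using weighted_bergman_space_growth[OF assms(1) f] by blast
  have bound: "(norm (F z))\<^sup>2 * (1 - norm z) powr (\<alpha> + 2) \<le> C" if z: "norm z < 1" for z
  proof -
    have "norm (F z) \<le> norm (f z)"
      using z by (simp add: F_def norm_mult norm_power mult_left_le_one_le power_le_one)
    then have "(norm (F z))\<^sup>2 * (1 - norm z) powr (\<alpha> + 2) \<le> (norm (f z))\<^sup>2 * (1 - norm z) powr (\<alpha> + 2)"
      by (intro mult_right_mono power_mono) auto
    then show ?thesis using C[OF z] by linarith
  qed
  have F0: "F z = 0" if z: "norm z < 1" for z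
  proof (rule ccontr)
    assume "F z \<noteq> 0"
    have "\<alpha> + 2 > 0" "\<alpha> + 2 < \<gamma>"
      using assms(1,2) by (auto simp: \<gamma>_def)
    then obtain a where a: "norm a < 1" "F a \<noteq> 0"
      and max: "\<And>z. norm z < 1 \<Longrightarrow>
        (norm (F z))\<^sup>2 * (1 - (norm z)\<^sup>2) powr \<gamma> \<le> (norm (F a))\<^sup>2 * (1 - (norm a)\<^sup>2) powr \<gamma>"
      using weighted_norm_attains_max[OF holomorphic_on_imp_continuous_on[OF holF] _ _ bound z \<open>F z \<noteq> 0\<close>]
      by blast
    \<comment> \<open>On \<open>K\<close> the added zero of order \<open>N\<close> at 0 serves, with
      \<open>h = f\<close>; elsewhere a point of \<open>X\<close> does, and z^N goes into the
      cofactor. This also works when \<open>l = 0\<close>.\<close>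
    obtain l m h where lm: "norm l < 1" "m \<ge> 1" "h holomorphic_on ball 0 1"
      "\<And>z. z \<in> ball 0 1 \<Longrightarrow> F z = (z - l) ^ m * h z"
      "a \<in> pseudohyperbolic_disk l (sqrt (real m / (real m + \<gamma>)))"
    proof (cases "a \<in> K")
      case True
      then have "a \<in> pseudohyperbolic_disk 0 (sqrt (real N / (real N + \<gamma>)))"
        using s(2)[of a] N a by (auto simp: pseudohyperbolic_disk_def)
      then show ?thesis
        using that[of 0 N f] N holf by (auto simp: F_def)
    next
      case False
      then have "a \<in> (\<Union>(l, m)\<in>X. pseudohyperbolic_disk l (sqrt (real m / (real m + \<alpha> + 2 + \<epsilon>))))"
        using assms(6) a by simp
      then obtain l m where X: "(l, m) \<in> X"
        and al: "a \<in> pseudohyperbolic_disk l (sqrt (real m / (real m + \<gamma>)))"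
        by (auto simp: \<gamma>_def add.assoc)
      have l: "norm l < 1" "m \<ge> 1"
        using X assms(3) by (auto simp: divisor_def)
      obtain h where h: "h holomorphic_on ball 0 1" "\<And>z. z \<in> ball 0 1 \<Longrightarrow> f z = (z - l) ^ m * h z"
      proof (rule holomorphic_factor_of_higher_deriv_zero[OF holf, of l m])
        show "(deriv ^^ j) f l = 0" if "j < m" for j
          using van X that by blast
      qed (use l in auto)
      have "(\<lambda>z. z ^ N * h z) holomorphic_on ball 0 1"
        by (intro holomorphic_intros h)
      then show ?thesis
        using that[of l m "\<lambda>z. z ^ N * h z"] l al h(2) by (simp add: F_def)
    qed
    obtain y where "norm y < 1"
      "(norm (F a))\<^sup>2 * (1 - (norm a)\<^sup>2) powr \<gamma> < (norm (F y))\<^sup>2 * (1 - (norm y)\<^sup>2) powr \<gamma>"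
      using weighted_norm_exceeded[OF lm(3,1,2) \<gamma> lm(4,5) a(2)] by blast
    then show False
      using max[of y] by simp
  qed
  show "f z0 = 0"
  \<comment> \<open>\<open>F = 0\<close> yields \<open>f = 0\<close> only away from the origin; the
    origin is a limit point of that set.\<close>
  proof (rule analytic_continuation[OF holf, of "ball 0 1 - {0}" "0"])
    show "(0::complex) islimpt ball 0 1 - {0}"
      using interior_limit_point[of "0::complex" "ball 0 1"] islimpt_punctured by auto
  qed (use z0 F0 in \<open>auto simp: F_def\<close>)
qed

end
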